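(* Let $p$ and $q$ be distinct primes, and let $a,\eta\in\mathbb{N}$. Then the following statements hold. (i) If $\gcd(a,pq)=pq$, then $a^{\eta}\equiv 0 \pmod{pq}$. (ii) If $\gcd(a,pq)=1$, then $a^{\operatorname{lcm}(p-1,q-1)\,\eta}\equiv 1 \pmod{pq}$. (iii) If $\gcd(a,pq)=q$, then $a^{(p-1)\eta}\equiv q\,q_p \pmod{pq}$. (iv) If $\gcd(a,pq)=p$, then $a^{(q-1)\eta}\equiv 1-q\,q_p \pmod{pq}$. Moreover, in this case $pq+1-q\,q_p$ is the remainder when $a^{(q-1)\eta}$ is divided by $pq$.
   Context: $\mathbb{N}$ denotes the set of positive integers. For a prime $p$ and $m\in\mathbb{N}$ not divisible by $p$, $m_p\in\{1,2,\dots,p-1\}$ denotes the multiplicative inverse of $m$ modulo $p$, i.e. the unique element of $\{1,\dots,p-1\}$ with $m\, m_p\equiv 1 \pmod p$. In particular $q_p$ is the inverse of $q$ modulo $p$. Congruences are between integers. *)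

theory Defs
  imports "HOL-Number_Theory.Number_Theory" "HOL-Number_Theory.Modular_Inverse"
begin

text \<open>
  For a prime \<open>p\<close> and a positive integer \<open>m\<close> not divisible by \<open>p\<close>, the inverse
  \<open>m\<^sub>p \<in> {1,\<dots>,p - 1}\<close> is rendered by the library function \<open>modular_inverse p m\<close> on the
  integers (note the order of the arguments). The following lemma confirms that this is the
  unique element of \<open>{1,\<dots>,p - 1}\<close> inverting \<open>m\<close> modulo \<open>p\<close>.
\<close>

lemma modular_inverse_unique:
  fixes p m :: nat and x :: int
  assumes "prime p" and "\<not> p dvd m"
  shows "x \<in> {1..int p - 1} \<and> [int m * x = 1] (mod int p) \<longleftrightarrow> x = modular_inverse (int p) (int m)"
proof
  assume "x \<in> {1..int p - 1} \<and> [int m * x = 1] (mod int p)"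
  then show "x = modular_inverse (int p) (int m)"
    by (intro modular_inverse_int_eqI[symmetric]) auto
next
  assume x: "x = modular_inverse (int p) (int m)"
  have p: "int p > 1"
    using assms(1) prime_gt_1_nat by simp
  have "coprime m p"
    using assms by (metis coprime_commute prime_imp_coprime)
  then have inv: "[int m * x = 1] (mod int p)"
    unfolding x by (intro cong_modular_inverse1) simp
  have "x \<noteq> 0"
    using inv p by (auto simp: cong_def)
  then show "x \<in> {1..int p - 1} \<and> [int m * x = 1] (mod int p)"
    using inv p modular_inverse_int_nonneg[of "int p" "int m"]
      modular_inverse_int_less[of "int p" "int m"] x by simp
qed

end

theory Submission
  imports Defs
begin

text \<open>
  By the Chinese remainder theorem each congruence may be checked modulo \<open>p\<close> and modulo \<open>q\<close>
  separately, where the power is \<open>0\<close> or, by Fermat, \<open>1\<close>; likewise \<open>q q\<^sub>p\<close> is \<open>1\<close> modulo \<open>p\<close>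
  and \<open>0\<close> modulo \<open>q\<close>. The remainder in (iv) follows from \<open>1 < q q\<^sub>p < p q\<close>.
\<close>

text \<open>As \<open>k\<close> is a multiple of \<open>p - 1\<close>, the power is itself a power
  of \<open>a ^ (p - 1)\<close>. Asking only for divisibility covers both the exponents with factor
  \<open>p - 1\<close> or \<open>q - 1\<close> and those with the lcm.\<close>

lemma fermat_cong_dvd:
  fixes p a k :: nat
  assumes "prime p" "\<not> p dvd a" "p - 1 dvd k"
  shows "[int a ^ k = 1] (mod int p)"
proof -
  obtain m where "k = (p - 1) * m"
    using assms(3) by blast
  then have "[a ^ k = 1] (mod p)"
    using cong_pow[OF fermat_theorem[OF assms(1,2)], of m] by (simp add: power_mult)
  then show ?thesis
    by (metis cong_int_iff of_nat_1 of_nat_power)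
qed

lemma power_cong_0:
  fixes p a k :: nat
  assumes "p dvd a" "k > 0"
  shows "[int a ^ k = 0] (mod int p)"
  using assms by (simp add: cong_0_iff dvd_power_le dvd_trans[OF _ dvd_power])

lemma cong_int_mult_primes:
  fixes p q :: nat and x y :: int
  assumes "prime p" "prime q" "p \<noteq> q" "[x = y] (mod int p)" "[x = y] (mod int q)"
  shows "[x = y] (mod int (p * q))"
  using assms by (simp add: coprime_cong_mult primes_coprime)

theorem theorem3:
  fixes p q a \<eta> :: nat
  assumes "prime p" and "prime q" and "p \<noteq> q" and "a > 0" and "\<eta> > 0"
  shows "(gcd a (p * q) = p * q \<longrightarrow> [int a ^ \<eta> = 0] (mod int (p * q)))
    \<and> (gcd a (p * q) = 1 \<longrightarrow> [int a ^ (lcm (p - 1) (q - 1) * \<eta>) = 1] (mod int (p * q)))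
    \<and> (gcd a (p * q) = q \<longrightarrow>
         [int a ^ ((p - 1) * \<eta>) = int q * modular_inverse (int p) (int q)] (mod int (p * q)))
    \<and> (gcd a (p * q) = p \<longrightarrow>
         [int a ^ ((q - 1) * \<eta>) = 1 - int q * modular_inverse (int p) (int q)] (mod int (p * q))
         \<and> int a ^ ((q - 1) * \<eta>) mod int (p * q)
             = int (p * q) + 1 - int q * modular_inverse (int p) (int q))"
proof (intro conjI impI)
  \<comment> \<open>Each case prescribes the gcd, so these equivalences decide which of the two
    primes divide \<open>a\<close>.\<close>
  have dvd_gcd: "p dvd a \<longleftrightarrow> p dvd gcd a (p * q)" "q dvd a \<longleftrightarrow> q dvd gcd a (p * q)"
    by simp_all
  have ndvd: "\<not> p dvd q" "\<not> q dvd p" "\<not> p dvd 1" "\<not> q dvd 1"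
    using assms(1-3) by (auto dest: primes_dvd_imp_eq)
  have pq: "p > 1" "q > 1"
    using assms(1,2) prime_gt_1_nat by auto
  define r where "r = modular_inverse (int p) (int q)"
  \<comment> \<open>At \<open>x = r\<close> the right side of \<open>modular_inverse_unique\<close>
    is the definition of \<open>r\<close>, so its left side yields all three facts.\<close>
  have r: "1 \<le> r" "r \<le> int p - 1" "[int q * r = 1] (mod int p)"
    using modular_inverse_unique[OF assms(1) ndvd(1), of r] by (auto simp: r_def)
  have r_q: "[int q * r = 0] (mod int q)"
    by (simp add: cong_0_iff)
  note crt = cong_int_mult_primes[OF assms(1-3)]

  \<comment> \<open>Here \<open>p * q\<close> itself divides \<open>a\<close>, so
    \<open>power_cong_0\<close> applies to the full modulus without splitting it.\<close>
  show "[int a ^ \<eta> = 0] (mod int (p * q))" if "gcd a (p * q) = p * q"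
    using that assms(5) by (intro power_cong_0) (metis gcd_dvd1)

  \<comment> \<open>Neither prime divides \<open>a\<close>, and the lcm is a multiple of both
    \<open>p - 1\<close> and \<open>q - 1\<close>, so Fermat applies modulo each prime.\<close>
  show "[int a ^ (lcm (p - 1) (q - 1) * \<eta>) = 1] (mod int (p * q))" if "gcd a (p * q) = 1"
    using that dvd_gcd ndvd assms(1,2) by (intro crt fermat_cong_dvd) (simp_all add: dvd_mult2)

  show "[int a ^ ((p - 1) * \<eta>) = int q * modular_inverse (int p) (int q)] (mod int (p * q))"
    if "gcd a (p * q) = q"
    unfolding r_def[symmetric]
  proof (rule crt)
    have "[int a ^ ((p - 1) * \<eta>) = 1] (mod int p)"
      using that dvd_gcd(1) ndvd(1) by (intro fermat_cong_dvd assms(1)) simp_all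
    then show "[int a ^ ((p - 1) * \<eta>) = int q * r] (mod int p)"
      using r(3) by (metis cong_sym cong_trans)
    \<comment> \<open>The exponent is positive because \<open>p > 1\<close> and
      \<open>\<eta> > 0\<close>; a zero exponent would give 1 instead.\<close>
    have "[int a ^ ((p - 1) * \<eta>) = 0] (mod int q)"
      using that dvd_gcd(2) pq assms(5) by (intro power_cong_0) simp_all
    then show "[int a ^ ((p - 1) * \<eta>) = int q * r] (mod int q)"
      using r_q by (metis cong_sym cong_trans)
  qed

  show iv: "[int a ^ ((q - 1) * \<eta>) = 1 - int q * modular_inverse (int p) (int q)] (mod int (p * q))"
    if "gcd a (p * q) = p"
    unfolding r_def[symmetric]
  proof (rule crt)
    have "[int a ^ ((q - 1) * \<eta>) = 0] (mod int p)"
      using that dvd_gcd(1) pq assms(5) by (intro power_cong_0) simp_all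
    moreover have "[1 - int q * r = 0] (mod int p)"
      using cong_diff[OF cong_refl r(3), of 1] by simp
    ultimately show "[int a ^ ((q - 1) * \<eta>) = 1 - int q * r] (mod int p)"
      by (metis cong_sym cong_trans)
    have "[int a ^ ((q - 1) * \<eta>) = 1] (mod int q)"
      using that dvd_gcd(2) ndvd(2) by (intro fermat_cong_dvd assms(2)) simp_all
    moreover have "[1 - int q * r = 1] (mod int q)"
      using cong_diff[OF cong_refl r_q, of 1] by simp
    ultimately show "[int a ^ ((q - 1) * \<eta>) = 1 - int q * r] (mod int q)"
      by (metis cong_sym cong_trans)
  qed

  show "int a ^ ((q - 1) * \<eta>) mod int (p * q)
      = int (p * q) + 1 - int q * modular_inverse (int p) (int q)"
    if "gcd a (p * q) = p"
    unfolding r_def[symmetric]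
  proof -
    \<comment> \<open>Strictness here keeps the claimed remainder below \<open>p * q\<close>; the
      upper bound on \<open>q * r\<close> that follows keeps it nonnegative.\<close>
    have "1 < int q * r"
      using r(1) pq(2) by (intro less_1_mult') simp_all
    moreover have "int q * r \<le> int q * (int p - 1)"
      using r(2) by (intro mult_left_mono) simp_all
    ultimately have bounds: "0 \<le> int (p * q) + 1 - int q * r" "int (p * q) + 1 - int q * r < int (p * q)"
      using pq by (simp_all add: algebra_simps)
    \<comment> \<open>The representative \<open>1 - q * r\<close> is negative; adding the modulus
      once moves it into the range of remainders.\<close>
    have "int a ^ ((q - 1) * \<eta>) mod int (p * q) = (int (p * q) + (1 - int q * r)) mod int (p * q)"
      using iv[OF that] unfolding cong_def r_def[symmetric] by (simp only: mod_add_self1)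
    also have "\<dots> = int (p * q) + 1 - int q * r"
      using mod_pos_pos_trivial[OF bounds] by (simp only: add_diff_eq)
    finally show "int a ^ ((q - 1) * \<eta>) mod int (p * q) = int (p * q) + 1 - int q * r" .
  qed
qed

end
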